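(* (1) Let $a>0$, $\gamma>0$ and $0<\beta<1$, and let $\Gamma(x,t)=x-t^\beta$. For each Schwartz function $f$ on $\mathbb R$, if $$\lim_{t\to0^+}\frac{P_{a,\gamma}^t(f)(\Gamma(x,t))-f(x)}{t^{\min\{\beta,\gamma\}}}=0\quad\text{for a.e. } x\in\mathbb R,$$ then $f\equiv 0$. (2) Let $a>0$ and $\gamma>0$. For each Schwartz function $f$ on $\mathbb R$, if $$\lim_{t\to0^+}\frac{P_{a,\gamma}^t(f)(x)-f(x)}{t^{\min\{1,\gamma\}}}=0\quad\text{for a.e. } x\in\mathbb R,$$ then $f\equiv 0$.
   Context: The Fourier transform is $\hat f(\xi)=\int_{\mathbb R}e^{-ix\xi}f(x)\,dx$. For $a>0$, $\gamma>0$, $t>0$, the Landau type Schrödinger operator is $$P_{a,\gamma}^t(f)(y)=\frac{1}{2\pi}\int_{\mathbb R}\hat f(\xi)e^{iy\xi}e^{it|\xi|^a}e^{-t^\gamma|\xi|^a}\,d\xi .$$ *)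

theory Defs
  imports "HOL-Analysis.Analysis"
begin

text \<open>The family \<open>D\<close> is uniquely determined: \<open>D k\<close> is the \<open>k\<close>-th derivative of \<open>f\<close>.\<close>

definition schwartz :: "(real \<Rightarrow> complex) \<Rightarrow> bool" where
  "schwartz f \<longleftrightarrow>
     (\<exists>D :: nat \<Rightarrow> real \<Rightarrow> complex.
        D 0 = f \<and>
        (\<forall>k x. (D k has_vector_derivative D (Suc k) x) (at x)) \<and>
        (\<forall>m k. \<exists>C. \<forall>x. \<bar>x\<bar> ^ m * norm (D k x) \<le> C))"

definition fourier :: "(real \<Rightarrow> complex) \<Rightarrow> real \<Rightarrow> complex" where
  "fourier f \<xi> = (LINT x|lborel. exp (- (\<i> * of_real (x * \<xi>))) * f x)"

text \<open>For \<open>a > 0\<close> and \<open>\<xi> = 0\<close> the convention \<open>0 powr a = 0\<close> gives the intended value of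
  the symbol.\<close>

definition landau_op :: "real \<Rightarrow> real \<Rightarrow> real \<Rightarrow> (real \<Rightarrow> complex) \<Rightarrow> real \<Rightarrow> complex" where
  "landau_op a \<gamma> t f y =
     1 / (2 * of_real pi) *
     (LINT \<xi>|lborel. fourier f \<xi> * exp (\<i> * of_real (y * \<xi>))
        * exp (\<i> * of_real (t * \<bar>\<xi>\<bar> powr a))
        * exp (of_real (- (t powr \<gamma> * \<bar>\<xi>\<bar> powr a))))"

definition shift_curve :: "real \<Rightarrow> real \<Rightarrow> real \<Rightarrow> real" where
  "shift_curve \<beta> x t = x - t powr \<beta>"

end

theory Submission
  imports Defs "HOL-Probability.Probability"
begin

text \<open>
  On the Fourier side the operator multiplies \<open>fourier f \<xi>\<close> by \<open>exp (w t \<xi>)\<close>, where evaluation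
  at \<open>x - d t\<close> instead of \<open>x\<close> contributes \<open>- \<i> * d t * \<xi>\<close> to the exponent
  \<open>w t \<xi> = \<i> * (t * \<bar>\<xi>\<bar> powr a - d t * \<xi>) - t powr \<gamma> * \<bar>\<xi>\<bar> powr a\<close>. If \<open>m\<close> is the smallest exponent of
  \<open>t\<close> that occurs, then \<open>(exp (w t \<xi>) - 1) / t powr m\<close> tends to the symbol \<open>M \<xi>\<close> that collects
  the terms of exactly this order. As \<open>Re (w t \<xi>) \<le> 0\<close>, the quotient is at most
  \<open>norm (w t \<xi>) / t powr m\<close>, hence polynomially bounded in \<open>\<xi>\<close> uniformly in \<open>t \<le> 1\<close>, while
  \<open>fourier f\<close> decays faster than every power. By dominated convergence and Fourier inversion
  the difference quotient of the theorem converges, at every \<open>x\<close>, to the inverse Fourier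
  transform of \<open>fourier f * M\<close>. The hypothesis says that this limit vanishes for almost every
  \<open>x\<close>; by Fourier uniqueness \<open>fourier f * M\<close> vanishes off the origin. The symbol has no zero there,
  so \<open>fourier f\<close> is zero almost everywhere, and so is \<open>f\<close>, everywhere by continuity.

  The symbol has no zero because its parts cannot cancel: the damping contributes the real number
  \<open>- \<bar>\<xi>\<bar> powr a\<close>, and the oscillating factors contribute imaginary numbers. Along the curve only
  \<open>- \<i> * \<xi>\<close> can appear, since \<open>\<beta> < 1\<close> makes the dispersive term \<open>t * \<bar>\<xi>\<bar> powr a\<close> of higher order;
  along the vertical line only \<open>\<i> * \<bar>\<xi>\<bar> powr a\<close> can.

  Both uses of the Fourier transform, inversion for \<open>f\<close> and uniqueness for \<open>fourier f * M\<close>, come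
  from one statement, \<open>fourier_inversion\<close>, obtained by Gaussian regularization. The limiting
  argument is \<open>multiplier_saturation\<close>, for abstract exponents, and \<open>landau_saturation\<close> instantiates
  it to the operator with a general shift \<open>d\<close>.
\<close>

section \<open>Fourier inversion by Gaussian regularization\<close>

lemma integrable_of_quadratic_decay:
  fixes g :: "real \<Rightarrow> 'a :: {banach, second_countable_topology}"
  assumes [measurable]: "g \<in> borel_measurable borel"
    and decay: "\<And>x. (1 + x\<^sup>2) * norm (g x) \<le> C"
  shows "integrable lborel g"
proof (rule Bochner_Integration.integrable_bound)
  have "integrable lborel (\<lambda>x::real. inverse (1 + x\<^sup>2))"
    using integrable_inverse_1_plus_square by (simp add: set_integrable_def)
  then show "integrable lborel (\<lambda>x::real. C * inverse (1 + x\<^sup>2))"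
    by simp
  show "AE x in lborel. norm (g x) \<le> norm (C * inverse (1 + x\<^sup>2))"
  proof (rule AE_I2)
    fix x :: real
    have "1 + x\<^sup>2 > 0"
      by (simp add: add_pos_nonneg)
    then have "norm (g x) \<le> C * inverse (1 + x\<^sup>2)"
      using decay[of x] by (simp add: field_simps)
    then show "norm (g x) \<le> norm (C * inverse (1 + x\<^sup>2))"
      by simp
  qed
qed simp

lemma integrable_fourier_integrand:
  assumes F: "integrable lborel F"
  shows "integrable lborel (\<lambda>x. exp (- (\<i> * of_real (x * \<xi>))) * F x)"
proof -
  have [measurable]: "F \<in> borel_measurable borel"
    using F by auto
  show ?thesis
    using F by (rule Bochner_Integration.integrable_bound) (auto simp: norm_mult)
qed

lemma norm_fourier_le: "norm (fourier F \<xi>) \<le> (LINT x|lborel. norm (F x))"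
proof -
  have "norm (fourier F \<xi>) \<le> (LINT x|lborel. norm (exp (- (\<i> * of_real (x * \<xi>))) * F x))"
    unfolding fourier_def by (rule integral_norm_bound)
  then show ?thesis by (simp add: norm_mult)
qed

lemma isCont_fourier:
  assumes F: "integrable lborel F"
  shows "isCont (fourier F) \<xi>"
proof (rule continuous_at_sequentiallyI)
  have [measurable]: "F \<in> borel_measurable borel"
    using F by auto
  fix u :: "nat \<Rightarrow> real"
  assume u: "u \<longlonglongrightarrow> \<xi>"
  show "(\<lambda>n. fourier F (u n)) \<longlonglongrightarrow> fourier F \<xi>"
    unfolding fourier_def
  proof (rule integral_dominated_convergence)
    show "integrable lborel (\<lambda>x. norm (F x))" using F by simp
    show "AE x in lborel. (\<lambda>n. exp (- (\<i> * of_real (x * u n))) * F x)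
        \<longlonglongrightarrow> exp (- (\<i> * of_real (x * \<xi>))) * F x"
      by (intro AE_I2 tendsto_intros u)
  qed (use F in \<open>auto simp: norm_mult\<close>)
qed

lemma borel_measurable_fourier:
  "integrable lborel F \<Longrightarrow> fourier F \<in> borel_measurable borel"
  by (intro borel_measurable_continuous_onI continuous_at_imp_continuous_on ballI isCont_fourier)

lemma fourier_std_normal_density:
  "(LINT u|lborel. of_real (std_normal_density u) * exp (\<i> * of_real (s * u)))
     = of_real (exp (- s\<^sup>2 / 2))"
proof -
  have "char std_normal_distribution s
      = (LINT u|lborel. std_normal_density u *\<^sub>R exp (\<i> * of_real (s * u)))"
    unfolding char_def by (subst integral_density) auto
  then show ?thesis
    by (simp add: char_std_normal_distribution scaleR_conv_of_real)
qed

text \<open>The dilation is what makes the regularization of the inversion integral removable: as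
  \<open>\<delta>\<close> tends to 0 the weight flattens to a constant, and its transform becomes an approximate
  identity at scale \<open>\<delta>\<close>.\<close>

lemma fourier_dilated_normal_density:
  assumes "\<delta> > 0"
  shows "(LINT \<xi>|lborel. of_real (std_normal_density (\<delta> * \<xi>)) * exp (\<i> * of_real (s * \<xi>)))
     = of_real (exp (- (s / \<delta>)\<^sup>2 / 2) / \<delta>)"
proof -
  have "of_real (exp (- (s / \<delta>)\<^sup>2 / 2)) =
      (LINT u|lborel. of_real (std_normal_density u) * exp (\<i> * of_real (s / \<delta> * u)))"
    by (rule fourier_std_normal_density[symmetric])
  also have "\<dots> = \<delta> *\<^sub>R (LINT \<xi>|lborel. of_real (std_normal_density (0 + \<delta> * \<xi>))
        * exp (\<i> * of_real (s / \<delta> * (0 + \<delta> * \<xi>))))"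
    using assms by (subst lborel_integral_real_affine[where c=\<delta> and t=0]) auto
  finally show ?thesis
    using assms by (simp add: scaleR_conv_of_real field_simps)
qed

lemma integrable_dilated_normal_density:
  "\<delta> > 0 \<Longrightarrow> integrable lborel (\<lambda>\<xi>. std_normal_density (\<delta> * \<xi>))"
  using lborel_integrable_real_affine[of std_normal_density \<delta> 0] by simp

text \<open>Inserting a Gaussian weight makes the double integral absolutely convergent, so Fubini applies,
  and the inner frequency integral is again a Gaussian, now concentrated near \<open>x\<close> at scale
  \<open>\<delta>\<close>. The substitution \<open>y = x + \<delta> * v\<close> puts the smoothing into a form that admits the limit
  \<open>\<delta> \<rightarrow> 0\<close>.\<close>

lemma gaussian_regularized_inversion:
  assumes F: "integrable lborel F" and \<delta>: "\<delta> > 0"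
  shows "(LINT \<xi>|lborel. fourier F \<xi> * exp (\<i> * of_real (x * \<xi>)) * of_real (std_normal_density (\<delta> * \<xi>)))
     = (LINT v|lborel. F (x + \<delta> * v) * of_real (exp (- v\<^sup>2 / 2)))"
proof -
  define G where "G = (\<lambda>\<xi> y. F y * (of_real (std_normal_density (\<delta> * \<xi>))
      * exp (\<i> * of_real ((x - y) * \<xi>))))"
  have [measurable]: "F \<in> borel_measurable borel"
    using F by auto
  have normG: "norm (G \<xi> y) = norm (F y) * std_normal_density (\<delta> * \<xi>)" for \<xi> y
    unfolding G_def by (simp add: norm_mult)
  have intG: "integrable lborel (\<lambda>y. G \<xi> y)" for \<xi>
    by (rule Bochner_Integration.integrable_bound[of _ "\<lambda>y. norm (F y) * std_normal_density (\<delta> * \<xi>)"])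
       (use F in \<open>auto simp: normG, auto simp: G_def\<close>)
  have int2: "integrable (lborel \<Otimes>\<^sub>M lborel) (\<lambda>(\<xi>, y). G \<xi> y)"
  proof (rule lborel_pair.Fubini_integrable)
    show "(\<lambda>(\<xi>, y). G \<xi> y) \<in> borel_measurable (lborel \<Otimes>\<^sub>M lborel)"
      unfolding G_def by measurable
    show "integrable lborel (\<lambda>\<xi>. LINT y|lborel. norm (case (\<xi>, y) of (\<xi>, y) \<Rightarrow> G \<xi> y))"
      using integrable_dilated_normal_density[OF \<delta>] by (simp add: normG)
    show "AE \<xi> in lborel. integrable lborel (\<lambda>y. case (\<xi>, y) of (\<xi>, y) \<Rightarrow> G \<xi> y)"
      using intG by simp
  qed
  have "(LINT \<xi>|lborel. fourier F \<xi> * exp (\<i> * of_real (x * \<xi>)) * of_real (std_normal_density (\<delta> * \<xi>)))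
      = (LINT \<xi>|lborel. LINT y|lborel. G \<xi> y)"
  proof (rule Bochner_Integration.integral_cong[OF refl])
    fix \<xi> :: real
    have "fourier F \<xi> * exp (\<i> * of_real (x * \<xi>)) * of_real (std_normal_density (\<delta> * \<xi>))
       = fourier F \<xi> * (exp (\<i> * of_real (x * \<xi>)) * of_real (std_normal_density (\<delta> * \<xi>)))"
      by simp
    also have "\<dots> = (LINT y|lborel. exp (- (\<i> * of_real (y * \<xi>))) * F y
          * (exp (\<i> * of_real (x * \<xi>)) * of_real (std_normal_density (\<delta> * \<xi>))))"
      unfolding fourier_def by (rule integral_mult_left_zero[symmetric])
    also have "\<dots> = (LINT y|lborel. G \<xi> y)"
    proof (rule Bochner_Integration.integral_cong[OF refl])
      fix y
      have "exp (\<i> * of_real ((x - y) * \<xi>)) = exp (- (\<i> * of_real (y * \<xi>))) * exp (\<i> * of_real (x * \<xi>))"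
        unfolding exp_add[symmetric] by (simp add: algebra_simps)
      then show "exp (- (\<i> * of_real (y * \<xi>))) * F y
          * (exp (\<i> * of_real (x * \<xi>)) * of_real (std_normal_density (\<delta> * \<xi>))) = G \<xi> y"
        unfolding G_def by (simp add: mult_ac)
    qed
    finally show "fourier F \<xi> * exp (\<i> * of_real (x * \<xi>)) * of_real (std_normal_density (\<delta> * \<xi>))
       = (LINT y|lborel. G \<xi> y)" .
  qed
  also have "\<dots> = (LINT y|lborel. LINT \<xi>|lborel. G \<xi> y)"
    using int2 by (rule lborel_pair.Fubini_integral[symmetric])
  also have "\<dots> = (LINT y|lborel. F y * of_real (exp (- ((x - y) / \<delta>)\<^sup>2 / 2) / \<delta>))"
    unfolding G_def by (simp only: integral_mult_right_zero fourier_dilated_normal_density[OF \<delta>])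
  also have "\<dots> = \<delta> *\<^sub>R (LINT v|lborel. F (x + \<delta> * v)
        * of_real (exp (- ((x - (x + \<delta> * v)) / \<delta>)\<^sup>2 / 2) / \<delta>))"
    using \<delta> by (subst lborel_integral_real_affine[where c=\<delta> and t=x]) auto
  also have "\<dots> = (LINT v|lborel. \<delta> *\<^sub>R (F (x + \<delta> * v)
        * of_real (exp (- ((x - (x + \<delta> * v)) / \<delta>)\<^sup>2 / 2) / \<delta>)))"
    by simp
  also have "\<dots> = (LINT v|lborel. F (x + \<delta> * v) * of_real (exp (- v\<^sup>2 / 2)))"
    using \<delta> by (intro Bochner_Integration.integral_cong) (auto simp: scaleR_conv_of_real)
  finally show ?thesis .
qed

text \<open>Let the regularization parameter tend to 0 in the preceding identity: integrability of the
  transform dominates one side, boundedness of \<open>F\<close> the other. Continuity is required at the one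
  point \<open>x\<close> only, which matters below, where \<open>F\<close> is a product with a symbol whose behaviour at the
  origin is left open.\<close>

lemma fourier_inversion:
  assumes F: "integrable lborel F" and bounded: "\<And>y. norm (F y) \<le> B"
    and cont: "isCont F x" and F': "integrable lborel (fourier F)"
  shows "(LINT \<xi>|lborel. fourier F \<xi> * exp (\<i> * of_real (x * \<xi>))) = of_real (2 * pi) * F x"
proof -
  define \<delta> where "\<delta> = (\<lambda>n. inverse (real (Suc n)))"
  have \<delta>: "\<delta> n > 0" "\<delta> \<longlonglongrightarrow> 0" for n
    unfolding \<delta>_def using LIMSEQ_inverse_real_of_nat by auto
  have [measurable]: "F \<in> borel_measurable borel" "fourier F \<in> borel_measurable borel"
    using F F' by auto
  have dens0: "std_normal_density 0 = 1 / sqrt (2 * pi)"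
    by (simp add: std_normal_density_def)
  have dens_le: "std_normal_density u \<le> std_normal_density 0" for u
    by (simp add: std_normal_density_def divide_right_mono)
  have dens_cont: "isCont std_normal_density u" for u
    unfolding std_normal_density_def by (intro continuous_intros) auto
  have gauss: "exp (- v\<^sup>2 / 2) = sqrt (2 * pi) * std_normal_density v" for v :: real
    by (simp add: std_normal_density_def)
  have "(\<lambda>n. LINT \<xi>|lborel. fourier F \<xi> * exp (\<i> * of_real (x * \<xi>))
          * of_real (std_normal_density (\<delta> n * \<xi>)))
      \<longlonglongrightarrow> (LINT \<xi>|lborel. fourier F \<xi> * exp (\<i> * of_real (x * \<xi>))
          * of_real (std_normal_density 0))"
  proof (rule integral_dominated_convergence)
    show "integrable lborel (\<lambda>\<xi>. norm (fourier F \<xi>) * std_normal_density 0)"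
      using F' by simp
    show "AE \<xi> in lborel. (\<lambda>n. fourier F \<xi> * exp (\<i> * of_real (x * \<xi>))
          * of_real (std_normal_density (\<delta> n * \<xi>)))
       \<longlonglongrightarrow> fourier F \<xi> * exp (\<i> * of_real (x * \<xi>)) * of_real (std_normal_density 0)"
    proof (intro AE_I2 tendsto_mult tendsto_const tendsto_of_real)
      fix \<xi> :: real
      show "(\<lambda>n. std_normal_density (\<delta> n * \<xi>)) \<longlonglongrightarrow> std_normal_density 0"
        by (rule isCont_tendsto_compose[OF dens_cont]) (use tendsto_mult_left_zero[OF \<delta>(2)] in simp)
    qed
    show "AE \<xi> in lborel. norm (fourier F \<xi> * exp (\<i> * of_real (x * \<xi>))
          * of_real (std_normal_density (\<delta> n * \<xi>))) \<le> norm (fourier F \<xi>) * std_normal_density 0" for n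
      using dens_le by (intro AE_I2) (auto simp: norm_mult intro!: mult_left_mono)
  qed auto
  then have lim1: "(\<lambda>n. LINT v|lborel. F (x + \<delta> n * v) * of_real (exp (- v\<^sup>2 / 2)))
      \<longlonglongrightarrow> (LINT \<xi>|lborel. fourier F \<xi> * exp (\<i> * of_real (x * \<xi>))) * of_real (std_normal_density 0)"
    by (simp only: gaussian_regularized_inversion[OF F \<delta>(1)] integral_mult_left_zero)
  have int_gauss: "integrable lborel (\<lambda>v::real. exp (- v\<^sup>2 / 2))"
    unfolding gauss by simp
  have lim2: "(\<lambda>n. LINT v|lborel. F (x + \<delta> n * v) * of_real (exp (- v\<^sup>2 / 2)))
      \<longlonglongrightarrow> (LINT v|lborel. F x * of_real (exp (- v\<^sup>2 / 2)))"
  proof (rule integral_dominated_convergence)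
    show "integrable lborel (\<lambda>v::real. B * exp (- v\<^sup>2 / 2))"
      using int_gauss by simp
    show "AE v in lborel. (\<lambda>n. F (x + \<delta> n * v) * of_real (exp (- v\<^sup>2 / 2)))
        \<longlonglongrightarrow> F x * of_real (exp (- v\<^sup>2 / 2))"
    proof (intro AE_I2 tendsto_mult tendsto_const)
      fix v :: real
      have "(\<lambda>n. x + \<delta> n * v) \<longlonglongrightarrow> x + 0 * v"
        by (intro tendsto_intros \<delta>)
      then show "(\<lambda>n. F (x + \<delta> n * v)) \<longlonglongrightarrow> F x"
        by (intro isCont_tendsto_compose[OF cont]) simp
    qed
    show "AE v in lborel. norm (F (x + \<delta> n * v) * of_real (exp (- v\<^sup>2 / 2))) \<le> B * exp (- v\<^sup>2 / 2)" for n
      using bounded by (intro AE_I2) (auto simp: norm_mult intro!: mult_right_mono)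
  qed auto
  have "(LINT v|lborel. F x * of_real (exp (- v\<^sup>2 / 2))) = F x * of_real (LINT v|lborel. exp (- v\<^sup>2 / 2))"
    by (simp only: integral_mult_right_zero integral_complex_of_real)
  also have "(LINT v|lborel. exp (- v\<^sup>2 / 2)) = sqrt (2 * pi)"
    unfolding gauss by simp
  finally have "(LINT \<xi>|lborel. fourier F \<xi> * exp (\<i> * of_real (x * \<xi>))) * of_real (std_normal_density 0)
      = F x * of_real (sqrt (2 * pi))"
    using LIMSEQ_unique[OF lim1 lim2] by simp
  then have "(LINT \<xi>|lborel. fourier F \<xi> * exp (\<i> * of_real (x * \<xi>)))
      = F x * of_real (sqrt (2 * pi) * sqrt (2 * pi))"
    unfolding dens0 of_real_mult by (simp add: field_simps)
  also have "sqrt (2 * pi) * sqrt (2 * pi) = 2 * pi"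
    by simp
  finally show ?thesis
    by (simp only: mult.commute)
qed

text \<open>Uniqueness is inversion in the case where integrability of the transform is automatic.\<close>

lemma eq_0_of_fourier_AE_0:
  assumes F: "integrable lborel F" and bounded: "\<And>y. norm (F y) \<le> B"
    and cont: "isCont F x" and zero: "AE \<xi> in lborel. fourier F \<xi> = 0"
  shows "F x = 0"
proof -
  have [measurable]: "fourier F \<in> borel_measurable borel"
    using F by (rule borel_measurable_fourier)
  have "integrable lborel (fourier F)"
    using zero by (subst integrable_cong_AE[where g="\<lambda>_. 0"]) auto
  then have "of_real (2 * pi) * F x = (LINT \<xi>|lborel. fourier F \<xi> * exp (\<i> * of_real (x * \<xi>)))"
    using fourier_inversion[OF F bounded cont] by simp
  also have "\<dots> = 0"
    using zero by (intro integral_eq_zero_AE) auto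
  finally show ?thesis
    by simp
qed

section \<open>Fourier transforms of Schwartz functions\<close>

text \<open>Integration by parts on the whole line, written as the fundamental theorem of calculus for
  \<open>exp (- \<i> x \<xi>) * F x\<close>: its derivative \<open>h\<close> is integrable with total integral 0, since the function
  vanishes at both ends.\<close>

lemma fourier_derivative:
  assumes F: "\<And>x. (F has_vector_derivative F' x) (at x)" and cont: "\<And>x. isCont F' x"
    and int: "integrable lborel F" "integrable lborel F'"
    and lim: "(F \<longlongrightarrow> 0) at_top" "(F \<longlongrightarrow> 0) at_bot"
  shows "fourier F' \<xi> = \<i> * of_real \<xi> * fourier F \<xi>"
proof -
  define e where "e = (\<lambda>x. exp (- (\<i> * of_real (x * \<xi>))))"
  have norm_e: "norm (e x) = 1" for x
    by (simp add: e_def)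
  have de: "(e has_vector_derivative - (\<i> * of_real \<xi>) * e x) (at x)" for x
    unfolding e_def
    by (rule has_vector_derivative_real_field[where f="\<lambda>z. exp (- (\<i> * (z * of_real \<xi>)))", simplified of_real_mult[symmetric]])
       (auto intro!: derivative_eq_intros)
  have contF: "isCont F x" for x
    using F by (rule has_vector_derivative_continuous)
  have conte: "isCont e x" for x
    using de by (rule has_vector_derivative_continuous)
  define h where "h = (\<lambda>x. e x * F' x - \<i> * of_real \<xi> * (e x * F x))"
  have inth1: "integrable lborel (\<lambda>x. e x * F' x)" and inth2: "integrable lborel (\<lambda>x. e x * F x)"
    unfolding e_def by (rule integrable_fourier_integrand[OF int(2)], rule integrable_fourier_integrand[OF int(1)])
  have inth: "integrable lborel h"
    unfolding h_def by (intro Bochner_Integration.integrable_diff integrable_mult_right inth1 inth2)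
  have lim0: "((\<lambda>x. e x * F x) \<longlongrightarrow> 0) G" if "(F \<longlongrightarrow> 0) G" for G
    by (rule tendsto_norm_zero_cancel) (use tendsto_norm_zero[OF that] in \<open>simp add: norm_mult norm_e\<close>)
  have "(LBINT x=-\<infinity>..\<infinity>. h x) = 0 - 0"
  proof (rule interval_integral_FTC_integrable[where F="\<lambda>x. e x * F x"])
    show "((\<lambda>x. e x * F x) has_vector_derivative h x) (at x)" for x
      using has_vector_derivative_mult[OF de F, of x] by (simp add: h_def algebra_simps)
    show "isCont h x" for x
      unfolding h_def by (intro continuous_intros conte contF cont)
    show "set_integrable lborel (einterval (- \<infinity>) \<infinity>) h"
      using inth by (simp add: set_integrable_def einterval_eq(4))
    show "(((\<lambda>x. e x * F x) \<circ> real_of_ereal) \<longlongrightarrow> 0) (at_right (- \<infinity>))"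
      by (simp add: ereal_tendsto_simps1 lim0 lim)
    show "(((\<lambda>x. e x * F x) \<circ> real_of_ereal) \<longlongrightarrow> 0) (at_left \<infinity>)"
      by (simp add: ereal_tendsto_simps1 lim0 lim)
  qed simp
  then have "(LINT x|lborel. h x) = 0"
    by (simp add: interval_lebesgue_integral_def set_lebesgue_integral_def einterval_eq(4))
  then have "(LINT x|lborel. e x * F' x) - \<i> * of_real \<xi> * (LINT x|lborel. e x * F x) = 0"
    unfolding h_def
    by (simp only: Bochner_Integration.integral_diff[OF inth1 integrable_mult_right[OF inth2]]
        integral_mult_right_zero)
  then show ?thesis
    unfolding fourier_def e_def by simp
qed

text \<open>The witness family of the Schwartz property, with the consequences of the decay estimates that
  are needed for every derivative.\<close>

lemma schwartz_derivativesE: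
  assumes "schwartz f"
  obtains D where "D 0 = f" "\<And>k x. (D k has_vector_derivative D (Suc k) x) (at x)"
    "\<And>k x. isCont (D k) x" "\<And>k. \<exists>B. \<forall>x. norm (D k x) \<le> B" "\<And>k. integrable lborel (D k)"
    "\<And>k. (D k \<longlongrightarrow> 0) at_infinity"
proof -
  obtain D where D: "D 0 = f" "\<And>k x. (D k has_vector_derivative D (Suc k) x) (at x)"
     "\<And>m k. \<exists>C. \<forall>x. \<bar>x\<bar> ^ m * norm (D k x) \<le> C"
    using assms unfolding schwartz_def by blast
  have cont: "isCont (D k) x" for k x
    using D(2) by (rule has_vector_derivative_continuous)
  have bounded: "\<exists>B. \<forall>x. norm (D k x) \<le> B" for k
    using D(3)[of 0 k] by simp
  have int: "integrable lborel (D k)" for k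
  proof -
    obtain C0 C2 where C: "\<And>x. \<bar>x\<bar> ^ 0 * norm (D k x) \<le> C0" "\<And>x. \<bar>x\<bar> ^ 2 * norm (D k x) \<le> C2"
      using D(3) by blast
    show ?thesis
    proof (rule integrable_of_quadratic_decay)
      show "D k \<in> borel_measurable borel"
        using cont by (intro borel_measurable_continuous_onI continuous_at_imp_continuous_on) auto
      show "(1 + x\<^sup>2) * norm (D k x) \<le> C0 + C2" for x
        using C(1)[of x] C(2)[of x] by (simp add: algebra_simps)
    qed
  qed
  have lim: "(D k \<longlongrightarrow> 0) at_infinity" for k
  proof -
    obtain C where C: "\<And>x. \<bar>x\<bar> ^ 1 * norm (D k x) \<le> C"
      using D(3) by blast
    show ?thesis
    proof (rule Lim_null_comparison)
      show "\<forall>\<^sub>F x in at_infinity. norm (D k x) \<le> norm (C / x)"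
        unfolding eventually_at_infinity
      proof (intro exI[of _ 1] allI impI)
        fix x :: real
        assume "1 \<le> norm x"
        then show "norm (D k x) \<le> norm (C / x)"
          using C[of x] by (simp add: field_simps)
      qed
      show "((\<lambda>x. norm (C / x)) \<longlongrightarrow> 0) at_infinity"
        by (intro tendsto_norm_zero tendsto_divide_0[OF tendsto_const] filterlim_ident)
    qed
  qed
  show thesis
    using D(1,2) cont bounded int lim by (rule that)
qed

lemma schwartz_regularity:
  assumes "schwartz f"
  shows schwartz_integrable: "integrable lborel f"
    and schwartz_bounded: "\<exists>B. \<forall>x. norm (f x) \<le> B"
    and schwartz_isCont: "isCont f x"
proof -
  obtain D where D: "D 0 = f" "\<And>k x. (D k has_vector_derivative D (Suc k) x) (at x)"
    "\<And>k x. isCont (D k) x" "\<And>k. \<exists>B. \<forall>x. norm (D k x) \<le> B" "\<And>k. integrable lborel (D k)"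
    "\<And>k. (D k \<longlongrightarrow> 0) at_infinity"
    by (rule schwartz_derivativesE[OF assms]) (rule that; assumption)
  show "integrable lborel f" "\<exists>B. \<forall>x. norm (f x) \<le> B" "isCont f x"
    unfolding D(1)[symmetric] using D(3-5) by blast+
qed

text \<open>Up to a unimodular factor, \<open>\<bar>\<xi>\<bar> ^ k * fourier f \<xi>\<close> is the transform of the integrable \<open>k\<close>-th
  derivative.\<close>

lemma schwartz_fourier_power_bounded:
  assumes "schwartz f"
  shows "\<exists>C. \<forall>\<xi>. \<bar>\<xi>\<bar> ^ k * norm (fourier f \<xi>) \<le> C"
proof -
  obtain D where D: "D 0 = f" "\<And>k x. (D k has_vector_derivative D (Suc k) x) (at x)"
    "\<And>k x. isCont (D k) x" "\<And>k. \<exists>B. \<forall>x. norm (D k x) \<le> B" "\<And>k. integrable lborel (D k)"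
    "\<And>k. (D k \<longlongrightarrow> 0) at_infinity"
    by (rule schwartz_derivativesE[OF assms]) (rule that; assumption)
  have lims: "(D k \<longlongrightarrow> 0) at_top" "(D k \<longlongrightarrow> 0) at_bot" for k
    using D(6) by (auto intro: tendsto_mono at_top_le_at_infinity at_bot_le_at_infinity)
  have "fourier (D k) \<xi> = (\<i> * of_real \<xi>) ^ k * fourier f \<xi>" for k \<xi>
  proof (induction k)
    case (Suc k)
    then show ?case
      using fourier_derivative[OF D(2) D(3) D(5) D(5) lims] by simp
  qed (simp add: D(1))
  then show ?thesis
    using norm_fourier_le[of "D k"] by (auto simp: norm_mult norm_power)
qed

text \<open>The weight \<open>1 + \<bar>\<xi>\<bar> ^ k\<close> is the form in which the growth of symbols is measured below:
  the integral supplies the dominating function, the bound makes \<open>fourier f * M\<close> bounded.\<close>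

lemma schwartz_fourier_weighted:
  assumes f: "schwartz f"
  shows "\<exists>B. \<forall>\<xi>. (1 + \<bar>\<xi>\<bar> ^ k) * norm (fourier f \<xi>) \<le> B"
    and "integrable lborel (\<lambda>\<xi>. (1 + \<bar>\<xi>\<bar> ^ k) * norm (fourier f \<xi>))"
proof -
  obtain C where C: "\<And>j \<xi>. \<bar>\<xi>\<bar> ^ j * norm (fourier f \<xi>) \<le> C j"
    using schwartz_fourier_power_bounded[OF f] by metis
  show "\<exists>B. \<forall>\<xi>. (1 + \<bar>\<xi>\<bar> ^ k) * norm (fourier f \<xi>) \<le> B"
    using C[of _ 0] C[of _ k] by (intro exI[of _ "C 0 + C k"]) (auto simp: distrib_right intro!: add_mono)
  have [measurable]: "fourier f \<in> borel_measurable borel"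
    using schwartz_integrable[OF f] by (rule borel_measurable_fourier)
  show "integrable lborel (\<lambda>\<xi>. (1 + \<bar>\<xi>\<bar> ^ k) * norm (fourier f \<xi>))"
  proof (rule integrable_of_quadratic_decay)
    fix \<xi> :: real
    have "(1 + \<xi>\<^sup>2) * norm ((1 + \<bar>\<xi>\<bar> ^ k) * norm (fourier f \<xi>))
        = (1 + \<bar>\<xi>\<bar>\<^sup>2) * (1 + \<bar>\<xi>\<bar> ^ k) * norm (fourier f \<xi>)"
      by (simp add: abs_mult)
    also have "\<dots> = \<bar>\<xi>\<bar> ^ 0 * norm (fourier f \<xi>) + \<bar>\<xi>\<bar> ^ 2 * norm (fourier f \<xi>)
        + \<bar>\<xi>\<bar> ^ k * norm (fourier f \<xi>) + \<bar>\<xi>\<bar> ^ (k + 2) * norm (fourier f \<xi>)"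
      by (simp add: algebra_simps power_add power2_eq_square)
    also have "\<dots> \<le> C 0 + C 2 + C k + C (k + 2)"
      by (intro add_mono C)
    finally show "(1 + \<xi>\<^sup>2) * norm ((1 + \<bar>\<xi>\<bar> ^ k) * norm (fourier f \<xi>)) \<le> C 0 + C 2 + C k + C (k + 2)" .
  qed simp
qed

lemma schwartz_fourier_inversion:
  assumes f: "schwartz f"
  shows "(LINT \<xi>|lborel. fourier f \<xi> * exp (\<i> * of_real (x * \<xi>))) = of_real (2 * pi) * f x"
proof -
  obtain B where "\<And>x. norm (f x) \<le> B"
    using schwartz_bounded[OF f] by blast
  moreover have "integrable lborel (fourier f)"
  proof (rule Bochner_Integration.integrable_bound)
    show "integrable lborel (\<lambda>\<xi>. (1 + \<bar>\<xi>\<bar> ^ 0) * norm (fourier f \<xi>))"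
      by (rule schwartz_fourier_weighted(2)[OF f])
    show "fourier f \<in> borel_measurable lborel"
      using borel_measurable_fourier[OF schwartz_integrable[OF f]] by simp
  qed auto
  ultimately show ?thesis
    using schwartz_integrable[OF f] schwartz_isCont[OF f] by (intro fourier_inversion)
qed

section \<open>Saturation for Fourier multipliers\<close>

text \<open>The half-plane is convex, and the derivative of \<open>exp\<close> is bounded by 1 on it. This keeps
  the difference quotients of the multipliers below polynomially growing majorants.\<close>

lemma norm_exp_minus_1_le:
  assumes "Re w \<le> 0"
  shows "norm (exp w - 1) \<le> norm w"
proof -
  have "norm (exp w - exp 0) \<le> 1 * norm (w - 0)"
  proof (rule field_differentiable_bound)
    show "convex {z. Re z \<le> 0}"
      by (rule convex_halfspace_Re_le)
    show "(exp has_field_derivative exp z) (at z within {z. Re z \<le> 0})" for z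
      by (rule DERIV_exp[THEN has_field_derivative_at_within])
    show "norm (exp z) \<le> 1" if "z \<in> {z. Re z \<le> 0}" for z
      using that by simp
  qed (use assms in auto)
  then show ?thesis
    by simp
qed

lemma tendsto_exp_minus_1_divide:
  fixes w :: "nat \<Rightarrow> complex"
  assumes s: "\<And>n. s n > 0" "s \<longlonglongrightarrow> 0" and w: "(\<lambda>n. w n / of_real (s n)) \<longlonglongrightarrow> M"
  shows "(\<lambda>n. (exp (w n) - 1) / of_real (s n)) \<longlonglongrightarrow> M"
proof -
  obtain g :: "complex \<Rightarrow> complex" where g: "\<And>z. exp z - 1 = g z * z" "isCont g 0" "g 0 = 1"
    using DERIV_exp[of "0::complex"] unfolding CARAT_DERIV by auto
  have "(\<lambda>n. w n / of_real (s n) * of_real (s n)) \<longlonglongrightarrow> M * of_real 0"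
    by (intro tendsto_mult w tendsto_of_real s)
  then have "w \<longlonglongrightarrow> 0"
    using s(1) by (simp add: less_imp_neq[symmetric])
  then have "(\<lambda>n. g (w n)) \<longlonglongrightarrow> 1"
    using isCont_tendsto_compose[OF g(2)] g(3) by metis
  from tendsto_mult[OF this w] show ?thesis
    by (simp add: g(1))
qed

text \<open>The scale \<open>s\<close> is the order to which the multipliers \<open>exp (w n \<xi>)\<close> approach 1, and \<open>M\<close> is the
  leading coefficient. If the multiplier operators reproduce \<open>f\<close> with an error \<open>o (s n)\<close> almost
  everywhere, then the leading error term, which has transform \<open>fourier f * M\<close>, must vanish.\<close>

lemma multiplier_saturation:
  fixes w :: "nat \<Rightarrow> real \<Rightarrow> complex"
  assumes f: "schwartz f" and s: "\<And>n. s n > 0" "s \<longlonglongrightarrow> 0"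
    and w_meas: "\<And>n. w n \<in> borel_measurable borel"
    and Re_w: "\<And>n \<xi>. Re (w n \<xi>) \<le> 0"
    and w_bound: "\<And>n \<xi>. norm (w n \<xi>) \<le> s n * (C * (1 + \<bar>\<xi>\<bar> ^ k))"
    and w_lim: "\<And>\<xi>. (\<lambda>n. w n \<xi> / of_real (s n)) \<longlonglongrightarrow> M \<xi>"
    and M_cont: "\<And>\<xi>. \<xi> \<noteq> 0 \<Longrightarrow> isCont M \<xi>" and M_nz: "\<And>\<xi>. \<xi> \<noteq> 0 \<Longrightarrow> M \<xi> \<noteq> 0"
    and rate: "AE x in lborel. (\<lambda>n. (1 / (2 * of_real pi) *
        (LINT \<xi>|lborel. fourier f \<xi> * exp (\<i> * of_real (x * \<xi>)) * exp (w n \<xi>)) - f x)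
          / of_real (s n)) \<longlonglongrightarrow> 0"
  shows "f x = 0"
proof -
  note [measurable] = w_meas
  have f_int: "integrable lborel f"
    by (rule schwartz_integrable[OF f])
  have [measurable]: "fourier f \<in> borel_measurable borel"
    using f_int by (rule borel_measurable_fourier)
  have [measurable]: "M \<in> borel_measurable borel"
    by (rule borel_measurable_LIMSEQ_metric[OF _ w_lim]) measurable
  define \<Phi> where "\<Phi> = (\<lambda>\<xi>. (1 + \<bar>\<xi>\<bar> ^ k) * norm (fourier f \<xi>))"
  have \<Phi>_int: "integrable lborel \<Phi>"
    unfolding \<Phi>_def by (rule schwartz_fourier_weighted(2)[OF f])
  obtain B where B: "\<And>\<xi>. \<Phi> \<xi> \<le> B"
    unfolding \<Phi>_def using schwartz_fourier_weighted(1)[OF f] by blast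
  have \<Phi>_ge: "norm (fourier f \<xi>) \<le> \<Phi> \<xi>" for \<xi>
    unfolding \<Phi>_def by (simp add: distrib_right)
  have quot_bound: "norm (w n \<xi> / of_real (s n)) \<le> C * (1 + \<bar>\<xi>\<bar> ^ k)" for n \<xi>
    using w_bound[of n \<xi>] s(1)[of n] by (simp add: norm_divide field_simps)
  have M_bound: "norm (M \<xi>) \<le> C * (1 + \<bar>\<xi>\<bar> ^ k)" for \<xi>
    by (rule LIMSEQ_le_const2[OF tendsto_norm[OF w_lim]]) (use quot_bound in blast)
  have fM_bound: "norm (fourier f \<xi> * M \<xi>) \<le> C * \<Phi> \<xi>" for \<xi>
    using mult_left_mono[OF M_bound[of \<xi>], of "norm (fourier f \<xi>)"]
    by (simp add: norm_mult \<Phi>_def mult_ac)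
  have C_nonneg: "C \<ge> 0"
    using order_trans[OF norm_ge_zero M_bound[of 0]] by (auto simp: zero_le_mult_iff power_0_left split: if_splits)
  \<comment> \<open>The reflection turns the inverse transform of the limit into a forward transform, to which
    the uniqueness lemma applies.\<close>
  define F where "F = (\<lambda>\<xi>. fourier f (- \<xi>) * M (- \<xi>))"
  have [measurable]: "F \<in> borel_measurable borel"
    unfolding F_def by measurable
  have fourier_F: "fourier F x = (LINT \<xi>|lborel. fourier f \<xi> * M \<xi> * exp (\<i> * of_real (x * \<xi>)))" for x
    unfolding fourier_def[of F]
    by (subst lborel_integral_real_affine[where c="-1" and t=0]) (auto simp: F_def mult_ac)
  have F_int: "integrable lborel F"
  proof (rule Bochner_Integration.integrable_bound)
    show "integrable lborel (\<lambda>\<xi>. C * \<Phi> (0 + - 1 * \<xi>))"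
      by (intro integrable_mult_right lborel_integrable_real_affine \<Phi>_int) auto
    show "AE \<xi> in lborel. norm (F \<xi>) \<le> norm (C * \<Phi> (0 + - 1 * \<xi>))"
      unfolding F_def by (intro AE_I2 order_trans[OF fM_bound]) auto
  qed auto
  have F_bound: "norm (F \<xi>) \<le> C * B" for \<xi>
    unfolding F_def using fM_bound B C_nonneg by (meson mult_left_mono order_trans)
  have F_cont: "isCont F \<xi>" if "\<xi> \<noteq> 0" for \<xi>
    unfolding F_def using that
    by (intro continuous_intros isCont_o2[OF _ isCont_fourier[OF f_int]] isCont_o2[OF _ M_cont]) auto
  have "AE x in lborel. fourier F x = 0"
    using rate
  proof eventually_elim
    case (elim x)
    have "(\<lambda>n. LINT \<xi>|lborel. fourier f \<xi> * exp (\<i> * of_real (x * \<xi>)) * ((exp (w n \<xi>) - 1) / of_real (s n)))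
        \<longlonglongrightarrow> (LINT \<xi>|lborel. fourier f \<xi> * exp (\<i> * of_real (x * \<xi>)) * M \<xi>)"
    proof (rule integral_dominated_convergence)
      show "integrable lborel (\<lambda>\<xi>. C * \<Phi> \<xi>)"
        using \<Phi>_int by simp
      show "AE \<xi> in lborel. (\<lambda>n. fourier f \<xi> * exp (\<i> * of_real (x * \<xi>)) * ((exp (w n \<xi>) - 1) / of_real (s n)))
          \<longlonglongrightarrow> fourier f \<xi> * exp (\<i> * of_real (x * \<xi>)) * M \<xi>"
        by (intro AE_I2 tendsto_mult tendsto_const tendsto_exp_minus_1_divide s w_lim)
      show "AE \<xi> in lborel. norm (fourier f \<xi> * exp (\<i> * of_real (x * \<xi>)) * ((exp (w n \<xi>) - 1) / of_real (s n)))
          \<le> C * \<Phi> \<xi>" for n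
      proof (rule AE_I2)
        fix \<xi>
        have "norm ((exp (w n \<xi>) - 1) / of_real (s n)) \<le> norm (w n \<xi> / of_real (s n))"
          using norm_exp_minus_1_le[OF Re_w] s(1)[of n] by (simp add: norm_divide divide_right_mono)
        also have "\<dots> \<le> C * (1 + \<bar>\<xi>\<bar> ^ k)"
          by (rule quot_bound)
        finally show "norm (fourier f \<xi> * exp (\<i> * of_real (x * \<xi>)) * ((exp (w n \<xi>) - 1) / of_real (s n)))
            \<le> C * \<Phi> \<xi>"
          unfolding \<Phi>_def norm_mult
          by (simp add: mult_left_mono mult.commute[of _ "norm (fourier f \<xi>)"] mult.left_commute[of C])
      qed
    qed measurable
    \<comment> \<open>The summand \<open>- 1\<close> integrates to \<open>- 2 * pi * f x\<close> by inversion, so these integrals are the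
      difference quotients of the hypothesis.\<close>
    moreover have "(LINT \<xi>|lborel. fourier f \<xi> * exp (\<i> * of_real (x * \<xi>)) * ((exp (w n \<xi>) - 1) / of_real (s n)))
        = 2 * of_real pi * ((1 / (2 * of_real pi) *
          (LINT \<xi>|lborel. fourier f \<xi> * exp (\<i> * of_real (x * \<xi>)) * exp (w n \<xi>)) - f x)
          / of_real (s n))" (is "?L = ?R") for n
    proof -
      have int: "integrable lborel (\<lambda>\<xi>. fourier f \<xi> * exp (\<i> * of_real (x * \<xi>)) * exp (w n \<xi>))"
        "integrable lborel (\<lambda>\<xi>. fourier f \<xi> * exp (\<i> * of_real (x * \<xi>)))"
      proof -
        have "norm (fourier f \<xi> * exp (\<i> * of_real (x * \<xi>)) * exp (w n \<xi>)) \<le> norm (\<Phi> \<xi>)"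
          "norm (fourier f \<xi> * exp (\<i> * of_real (x * \<xi>))) \<le> norm (\<Phi> \<xi>)" for \<xi>
          using \<Phi>_ge[of \<xi>] Re_w[of n \<xi>] order_trans[OF norm_ge_zero \<Phi>_ge]
            mult_mono[of "norm (fourier f \<xi>)" "\<Phi> \<xi>" "exp (Re (w n \<xi>))" 1]
          by (auto simp: norm_mult)
        then show "integrable lborel (\<lambda>\<xi>. fourier f \<xi> * exp (\<i> * of_real (x * \<xi>)) * exp (w n \<xi>))"
          "integrable lborel (\<lambda>\<xi>. fourier f \<xi> * exp (\<i> * of_real (x * \<xi>)))"
          by (auto intro!: Bochner_Integration.integrable_bound[OF \<Phi>_int] simp del: of_real_mult)
      qed
      have "?L = (LINT \<xi>|lborel. (fourier f \<xi> * exp (\<i> * of_real (x * \<xi>)) * exp (w n \<xi>)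
          - fourier f \<xi> * exp (\<i> * of_real (x * \<xi>))) / of_real (s n))"
        by (simp add: algebra_simps)
      also have "\<dots> = ((LINT \<xi>|lborel. fourier f \<xi> * exp (\<i> * of_real (x * \<xi>)) * exp (w n \<xi>))
          - of_real (2 * pi) * f x) / of_real (s n)"
        by (simp only: integral_divide_zero Bochner_Integration.integral_diff[OF int]
            schwartz_fourier_inversion[OF f])
      also have "\<dots> = ?R"
        by (simp add: right_diff_distrib)
      finally show ?thesis .
    qed
    moreover have "(\<lambda>n. 2 * of_real pi * ((1 / (2 * of_real pi) *
          (LINT \<xi>|lborel. fourier f \<xi> * exp (\<i> * of_real (x * \<xi>)) * exp (w n \<xi>)) - f x)
          / of_real (s n))) \<longlonglongrightarrow> 0"
      by (rule tendsto_mult_right_zero) (rule elim)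
    ultimately have "(LINT \<xi>|lborel. fourier f \<xi> * exp (\<i> * of_real (x * \<xi>)) * M \<xi>) = 0"
      by (simp only:) (rule LIMSEQ_unique)
    then show "fourier F x = 0"
      unfolding fourier_F by (simp add: mult_ac)
  qed
  then have F_zero: "F \<xi> = 0" if "\<xi> \<noteq> 0" for \<xi>
    using eq_0_of_fourier_AE_0[OF F_int F_bound F_cont] that by blast
  have "fourier f \<xi> = 0" if "\<xi> \<noteq> 0" for \<xi>
    using F_zero[of "- \<xi>"] M_nz[of \<xi>] that by (simp add: F_def)
  with AE_lborel_singleton[of 0] have f_zero: "AE \<xi> in lborel. fourier f \<xi> = 0"
    by (rule eventually_mono)
  obtain B' where "\<And>x. norm (f x) \<le> B'"
    using schwartz_bounded[OF f] by blast
  then show ?thesis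
    by (rule eq_0_of_fourier_AE_0[OF f_int _ schwartz_isCont[OF f] f_zero])
qed

section \<open>The Landau type operator along a shift\<close>

lemma tendsto_powr_quotient:
  fixes m p :: real
  assumes "m \<le> p"
  shows "((\<lambda>t. t powr p / t powr m) \<longlongrightarrow> (if p = m then 1 else 0)) (at_right 0)"
proof -
  have pos: "\<forall>\<^sub>F t :: real in at_right 0. t > 0"
    by (rule eventually_at_right_less)
  have "((\<lambda>t. t powr (p - m)) \<longlongrightarrow> (if p = m then 1 else 0)) (at_right 0)"
  proof (cases "p = m")
    case True
    then show ?thesis
      using pos by (auto intro!: tendsto_eventually elim: eventually_mono)
  next
    case False
    have "((\<lambda>t. t powr (p - m)) \<longlongrightarrow> 0 powr (p - m)) (at_right 0)"
      using False assms pos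
      by (intro tendsto_powr' tendsto_const tendsto_ident_at) (auto elim: eventually_mono)
    then show ?thesis
      using False by simp
  qed
  then show ?thesis
    by (simp add: powr_diff)
qed

lemma abs_powr_le_1_plus_power:
  fixes \<xi> :: real
  assumes "0 < p" "p \<le> real k"
  shows "\<bar>\<xi>\<bar> powr p \<le> 1 + \<bar>\<xi>\<bar> ^ k"
proof (cases "\<bar>\<xi>\<bar> \<le> 1")
  case True
  then have "\<bar>\<xi>\<bar> powr p \<le> 1"
    using assms by (intro powr_le1) auto
  then show ?thesis
    by (simp add: add_increasing2)
next
  case False
  then have "\<bar>\<xi>\<bar> powr p \<le> \<bar>\<xi>\<bar> powr real k"
    using assms by (intro powr_mono) auto
  also have "\<dots> = \<bar>\<xi>\<bar> ^ k"
    using False by (intro powr_realpow) auto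
  finally show ?thesis
    by simp
qed

text \<open>A shift \<open>d\<close> of order at least \<open>m\<close> covers the tangential curve (\<open>d t = t powr \<beta>\<close>) and the vertical
  line (\<open>d t = 0\<close>) at once. The symbol has real part \<open>- \<bar>\<xi>\<bar> powr a\<close> if \<open>m = \<gamma>\<close>, and 0 otherwise; its
  imaginary part is the difference of the two sides in the last alternative of the
  nondegeneracy hypothesis.\<close>

lemma landau_saturation:
  assumes a: "a > 0" and f: "schwartz f" and m: "0 < m" "m \<le> \<gamma>" "m \<le> 1"
    and d_bound: "\<And>t. 0 < t \<Longrightarrow> t \<le> 1 \<Longrightarrow> \<bar>d t\<bar> \<le> t powr m"
    and d_lim: "((\<lambda>t. d t / t powr m) \<longlongrightarrow> \<delta>) (at_right 0)"
    and nondeg: "\<And>\<xi>. \<xi> \<noteq> 0 \<Longrightarrow> m = \<gamma> \<or> (if m = 1 then \<bar>\<xi>\<bar> powr a else 0) \<noteq> \<delta> * \<xi>"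
    and rate: "AE x in lborel. ((\<lambda>t. (landau_op a \<gamma> t f (x - d t) - f x) / of_real (t powr m))
      \<longlongrightarrow> 0) (at_right 0)"
  shows "f x = 0"
proof -
  define t where "t = (\<lambda>n. inverse (real (Suc n)))"
  have t: "t n > 0" "t n \<le> 1" "t \<longlonglongrightarrow> 0" for n
    unfolding t_def using LIMSEQ_inverse_real_of_nat by (auto simp: field_simps)
  have t_right: "filterlim t (at_right 0) sequentially"
    unfolding filterlim_at using t(1,3) by (auto intro!: always_eventually simp: less_imp_neq[symmetric])
  define s where "s = (\<lambda>n. t n powr m)"
  define w where "w = (\<lambda>n \<xi>. \<i> * of_real (t n * \<bar>\<xi>\<bar> powr a - d (t n) * \<xi>)
      - of_real (t n powr \<gamma> * \<bar>\<xi>\<bar> powr a))"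
  \<comment> \<open>A natural exponent that dominates both \<open>\<bar>\<xi>\<bar> powr a\<close> and the linear term of the shift.\<close>
  define k where "k = Suc (nat \<lceil>a\<rceil>)"
  have powr_le_s: "t n powr p \<le> s n" if "m \<le> p" for n p
    unfolding s_def using that t by (intro powr_mono') (auto intro: less_imp_le)
  have t_le_s: "t n \<le> s n" for n
    using powr_le_s[OF m(3), of n] t(1)[of n] by simp
  have "a \<le> real k" "1 \<le> real k"
    unfolding k_def using a by linarith+
  then have power_bounds: "\<bar>\<xi>\<bar> powr a \<le> 1 + \<bar>\<xi>\<bar> ^ k" "\<bar>\<xi>\<bar> \<le> 1 + \<bar>\<xi>\<bar> ^ k" for \<xi> :: real
    using abs_powr_le_1_plus_power[of a k \<xi>] abs_powr_le_1_plus_power[of 1 k \<xi>] a by auto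
  have powr_cont: "isCont (\<lambda>\<xi>. \<bar>\<xi>\<bar> powr a) \<xi>" if "\<xi> \<noteq> 0" for \<xi> :: real
    using that by (intro continuous_intros) auto
  \<comment> \<open>The constant 3 counts the three terms of the exponent, each at most \<open>s n * (1 + \<bar>\<xi>\<bar> ^ k)\<close>.\<close>
  show ?thesis
  proof (rule multiplier_saturation[OF f, of s w 3 k
        "\<lambda>\<xi>. \<i> * of_real ((if m = 1 then 1 else 0) * \<bar>\<xi>\<bar> powr a - \<delta> * \<xi>)
            - of_real ((if \<gamma> = m then 1 else 0) * \<bar>\<xi>\<bar> powr a)"])
    show "s n > 0" for n
      unfolding s_def using t(1)[of n] by simp
    have "s \<longlonglongrightarrow> 0 powr m"
      unfolding s_def using t m by (intro tendsto_powr' tendsto_const) (auto intro!: always_eventually less_imp_le)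
    then show "s \<longlonglongrightarrow> 0"
      by simp
    show "w n \<in> borel_measurable borel" for n
      unfolding w_def by measurable
    show "Re (w n \<xi>) \<le> 0" for n \<xi>
      unfolding w_def by simp
    show "norm (w n \<xi>) \<le> s n * (3 * (1 + \<bar>\<xi>\<bar> ^ k))" for n \<xi>
    proof -
      have "norm (w n \<xi>) \<le> \<bar>t n * \<bar>\<xi>\<bar> powr a - d (t n) * \<xi>\<bar> + \<bar>t n powr \<gamma> * \<bar>\<xi>\<bar> powr a\<bar>"
        unfolding w_def by (rule order_trans[OF norm_triangle_ineq4]) (simp add: norm_mult del: of_real_diff of_real_mult)
      also have "\<dots> \<le> t n * \<bar>\<xi>\<bar> powr a + \<bar>d (t n)\<bar> * \<bar>\<xi>\<bar> + t n powr \<gamma> * \<bar>\<xi>\<bar> powr a"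
        using t(1)[of n] by (intro add_mono order_trans[OF abs_triangle_ineq4]) (auto simp: abs_mult)
      also have "\<dots> \<le> s n * (1 + \<bar>\<xi>\<bar> ^ k) + s n * (1 + \<bar>\<xi>\<bar> ^ k) + s n * (1 + \<bar>\<xi>\<bar> ^ k)"
        using t_le_s[of n] powr_le_s[OF m(2), of n] d_bound[OF t(1,2), of n] power_bounds[of \<xi>] t(1)[of n]
        by (intro add_mono mult_mono) (auto simp: s_def)
      finally show ?thesis
        by (simp add: algebra_simps)
    qed
    show "(\<lambda>n. w n \<xi> / of_real (s n)) \<longlonglongrightarrow>
        \<i> * of_real ((if m = 1 then 1 else 0) * \<bar>\<xi>\<bar> powr a - \<delta> * \<xi>)
            - of_real ((if \<gamma> = m then 1 else 0) * \<bar>\<xi>\<bar> powr a)" for \<xi>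
    proof -
      have lim_t: "(\<lambda>n. t n powr p / s n) \<longlonglongrightarrow> (if p = m then 1 else 0)" if "m \<le> p" for p
        unfolding s_def using filterlim_compose[OF tendsto_powr_quotient[OF that] t_right] .
      have lim_1: "(\<lambda>n. t n / s n) \<longlonglongrightarrow> (if m = 1 then 1 else 0)"
        using lim_t[OF m(3)] t(1) by (simp add: less_imp_le)
      have lim_d: "(\<lambda>n. d (t n) / s n) \<longlonglongrightarrow> \<delta>"
        unfolding s_def using filterlim_compose[OF d_lim t_right] .
      have "w n \<xi> / of_real (s n) = \<i> * of_real (t n / s n * \<bar>\<xi>\<bar> powr a - d (t n) / s n * \<xi>)
          - of_real (t n powr \<gamma> / s n * \<bar>\<xi>\<bar> powr a)" for n
        unfolding w_def by (simp add: diff_divide_distrib right_diff_distrib)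
      then show ?thesis
        by (simp only:) (intro tendsto_intros lim_1 lim_d lim_t[OF m(2)])
    qed
    show "isCont (\<lambda>\<xi>. \<i> * of_real ((if m = 1 then 1 else 0) * \<bar>\<xi>\<bar> powr a - \<delta> * \<xi>)
            - of_real ((if \<gamma> = m then 1 else 0) * \<bar>\<xi>\<bar> powr a)) \<xi>" if "\<xi> \<noteq> 0" for \<xi>
      by (intro isCont_diff isCont_mult continuous_const isCont_of_real powr_cont[OF that] continuous_ident)
    show "\<i> * of_real ((if m = 1 then 1 else 0) * \<bar>\<xi>\<bar> powr a - \<delta> * \<xi>)
            - of_real ((if \<gamma> = m then 1 else 0) * \<bar>\<xi>\<bar> powr a) \<noteq> 0" if "\<xi> \<noteq> 0" for \<xi>
      using nondeg[OF that] that by (auto simp: complex_eq_iff split: if_splits)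
    show "AE x in lborel. (\<lambda>n. (1 / (2 * of_real pi) *
        (LINT \<xi>|lborel. fourier f \<xi> * exp (\<i> * of_real (x * \<xi>)) * exp (w n \<xi>)) - f x)
          / of_real (s n)) \<longlonglongrightarrow> 0"
      using rate
    proof eventually_elim
      case (elim x)
      have "landau_op a \<gamma> (t n) f (x - d (t n)) = 1 / (2 * of_real pi) *
        (LINT \<xi>|lborel. fourier f \<xi> * exp (\<i> * of_real (x * \<xi>)) * exp (w n \<xi>))" for n
      proof -
        have "exp (\<i> * of_real ((x - d (t n)) * \<xi>)) * exp (\<i> * of_real (t n * \<bar>\<xi>\<bar> powr a))
            * exp (of_real (- (t n powr \<gamma> * \<bar>\<xi>\<bar> powr a)))
            = exp (\<i> * of_real (x * \<xi>)) * exp (w n \<xi>)" for \<xi>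
          unfolding w_def exp_add[symmetric] by (simp add: algebra_simps)
        then show ?thesis
          unfolding landau_op_def by (simp only: mult.assoc)
      qed
      then show ?case
        using filterlim_compose[OF elim t_right] by (simp add: s_def)
    qed
  qed
qed

theorem theorem2p10:
  "(\<forall>a \<gamma> \<beta> f. a > 0 \<longrightarrow> \<gamma> > 0 \<longrightarrow> 0 < \<beta> \<longrightarrow> \<beta> < 1 \<longrightarrow> schwartz f \<longrightarrow>
      (AE x in lborel.
         ((\<lambda>t. (landau_op a \<gamma> t f (shift_curve \<beta> x t) - f x) / of_real (t powr min \<beta> \<gamma>))
            \<longlongrightarrow> 0) (at_right 0)) \<longrightarrow>
      (\<forall>x. f x = 0))
   \<and>
   (\<forall>a \<gamma> f. a > 0 \<longrightarrow> \<gamma> > 0 \<longrightarrow> schwartz f \<longrightarrow>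
      (AE x in lborel.
         ((\<lambda>t. (landau_op a \<gamma> t f x - f x) / of_real (t powr min 1 \<gamma>))
            \<longlongrightarrow> 0) (at_right 0)) \<longrightarrow>
      (\<forall>x. f x = 0))"
proof (intro conjI allI impI)
  fix a \<gamma> \<beta> :: real and f x
  assume *: "a > 0" "\<gamma> > 0" "0 < \<beta>" "\<beta> < 1" "schwartz f"
    and rate: "AE x in lborel.
         ((\<lambda>t. (landau_op a \<gamma> t f (shift_curve \<beta> x t) - f x) / of_real (t powr min \<beta> \<gamma>))
            \<longlongrightarrow> 0) (at_right 0)"
  show "f x = 0"
  proof (rule landau_saturation[where a=a and \<gamma>=\<gamma> and m="min \<beta> \<gamma>" and d="\<lambda>t. t powr \<beta>"])
    show "\<bar>t powr \<beta>\<bar> \<le> t powr min \<beta> \<gamma>" if "0 < t" "t \<le> 1" for t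
      using that by (auto intro!: powr_mono')
    show "((\<lambda>t. t powr \<beta> / t powr min \<beta> \<gamma>) \<longlongrightarrow> (if \<beta> = min \<beta> \<gamma> then 1 else 0)) (at_right 0)"
      by (rule tendsto_powr_quotient) simp
    show "AE x in lborel. ((\<lambda>t. (landau_op a \<gamma> t f (x - t powr \<beta>) - f x) / of_real (t powr min \<beta> \<gamma>))
            \<longlongrightarrow> 0) (at_right 0)"
      using rate unfolding shift_curve_def .
    show "min \<beta> \<gamma> = \<gamma> \<or> (if min \<beta> \<gamma> = 1 then \<bar>\<xi>\<bar> powr a else 0)
        \<noteq> (if \<beta> = min \<beta> \<gamma> then 1 else 0) * \<xi>" if "\<xi> \<noteq> 0" for \<xi>
      using that *(4) by (cases "\<beta> \<le> \<gamma>") (simp_all add: min_absorb1 min_absorb2)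
    show "0 < min \<beta> \<gamma>" "min \<beta> \<gamma> \<le> \<gamma>" "min \<beta> \<gamma> \<le> 1"
      using *(2-4) by simp_all
  qed (rule *)+
next
  fix a \<gamma> :: real and f x
  assume *: "a > 0" "\<gamma> > 0" "schwartz f"
    and rate: "AE x in lborel.
         ((\<lambda>t. (landau_op a \<gamma> t f x - f x) / of_real (t powr min 1 \<gamma>))
            \<longlongrightarrow> 0) (at_right 0)"
  show "f x = 0"
  proof (rule landau_saturation[where a=a and \<gamma>=\<gamma> and m="min 1 \<gamma>" and d="\<lambda>_. 0" and \<delta>=0])
    show "min 1 \<gamma> = \<gamma> \<or> (if min 1 \<gamma> = 1 then \<bar>\<xi>\<bar> powr a else 0) \<noteq> 0 * \<xi>" if "\<xi> \<noteq> 0" for \<xi>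
      using that by (cases "1 \<le> \<gamma>") (simp_all add: min_absorb1 min_absorb2)
    show "0 < min 1 \<gamma>" "min 1 \<gamma> \<le> \<gamma>" "min 1 \<gamma> \<le> 1"
      using *(2) by simp_all
    show "AE x in lborel. ((\<lambda>t. (landau_op a \<gamma> t f (x - 0) - f x) / of_real (t powr min 1 \<gamma>))
            \<longlongrightarrow> 0) (at_right 0)"
      using rate unfolding diff_zero .
    show "((\<lambda>t. 0 / t powr min 1 \<gamma>) \<longlongrightarrow> 0) (at_right 0)"
      by simp
  qed (simp_all add: *)
qed

end
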